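(* Let $M$ be a smooth closed manifold of dimension $n\ge3$ and let $g_\infty$ be a unit-volume metric of constant scalar curvature on $M$ with order of integrability $p>3$. If $g_\infty$ is both degenerate and a strict local minimum of the Yamabe functional in its unit volume conformal class $[g_\infty]_1$, then $g_\infty$ satisfies the condition $AS_p$.
   Context: Let $N=\frac{2n}{n-2}$ and fix $\alpha\in(0,1)$. $R_g$ is the scalar curvature of $g$. The Yamabe functional is $\mathcal Y(g)=\mathrm{Vol}(M,g)^{-2/N}\int_M R_g\,dV_g$. Let $[g_\infty]_1=\{w^{N-2}g_\infty: w\in C^{2,\alpha}(M),\ w>0,\ \int_M w^N dV_{g_\infty}=1\}$; identify $w$ with $w^{N-2}g_\infty$ and write $\mathcal Y(w)$. Strict local minimum means $\mathcal Y(w)>\mathcal Y(1)$ for all $w\ne1$ in $[g_\infty]_1$ sufficiently close to $1$ in $C^{2,\alpha}$. $CSC_1$ is the set of constant scalar curvature metrics in $[g_\infty]_1$. Linearized Yamabe operator: $\mathcal L_\infty v=(n-1)\Delta_{g_\infty}v+R_{g_\infty}v$ ($\Delta$ the nonpositive Laplacian). $\Lambda_0$ is its (finite-dimensional) kernel, regarded as a subset of the mean-zero functions (automatic if $R_{g_\infty}\neq0$), with the $L^2(M,g_\infty)$ inner product; $\Lambda_0^\perp$ is its $L^2$-orthogonal complement. $g_\infty$ is degenerate if $\Lambda_0\neq0$. $g_\infty$ is integrable if for every $v\in\Lambda_0$ there are $\epsilon>0$ and a path $w(t)\in C^2((-\epsilon,\epsilon)\times M)$ with $w(t)^{N-2}g_\infty\in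 CSC_1$, $w(0)=1$, $w'(0)=v$; otherwise non-integrable. Lyapunov--Schmidt reduction: by the analytic implicit function theorem there are $\epsilon>0$ and an analytic map $\Phi:\{v\in\Lambda_0:\|v\|_{L^2}<\epsilon\}\to C^{2,\alpha}(M)\cap\Lambda_0^\perp$ (unique among maps with small values) with $\Phi(0)=0$, $D\Phi(0)=0$, such that $\Psi(v)=1+v+\Phi(v)$ is positive, $\mathrm{Vol}(M,\Psi(v)^{N-2}g_\infty)=1$, and the differential of $\mathcal Y$ on $[g_\infty]_1$ at $\Psi(v)$ vanishes on all tangent directions $\zeta\in C^{2,\alpha}\cap\Lambda_0^\perp$ (those with $\int_M\Psi(v)^{N-1}\zeta\,dV_{g_\infty}=0$). Set $F(v)=\mathcal Y(\Psi(v))$, analytic near $0\in\Lambda_0$. Integrability is equivalent to $F$ being constant near $0$. When $F$ is not constant near $0$, expand $F(v)=F(0)+\sum_{j\ge p}F_j(v)$ with $F_j$ a homogeneous polynomial of degree $j$ and $F_p\not\equiv0$; $p$ is the order of integrability. $g_\infty$ satisfies $AS_p$ (Adams--Simon positivity condition) if it is non-integrable with order of integrability $p$ and the restriction of $F_p$ to the unit sphere of $\Lambda_0$ attains a positive maximum. *)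

theory Defs
  imports "HOL-Analysis.Analysis"
begin

section \<open>Differentiability classes in Euclidean space\<close>

definition dir_deriv :: "'e \<Rightarrow> ('e::euclidean_space \<Rightarrow> 'b::real_normed_vector) \<Rightarrow> 'e \<Rightarrow> 'b" where
  "dir_deriv b f x = frechet_derivative f (at x) b"

abbreviation pd :: "'n::finite \<Rightarrow> (real^'n \<Rightarrow> 'b::real_normed_vector) \<Rightarrow> real^'n \<Rightarrow> 'b" where
  "pd i \<equiv> dir_deriv (axis i 1)"

text \<open>Only used on open sets.\<close>

primrec Ck_on :: "nat \<Rightarrow> ('e::euclidean_space \<Rightarrow> 'b::real_normed_vector) \<Rightarrow> 'e set \<Rightarrow> bool" where
  "Ck_on 0 f U \<longleftrightarrow> continuous_on U f"
| "Ck_on (Suc k) f U \<longleftrightarrow>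
     (\<forall>x\<in>U. f differentiable (at x)) \<and> (\<forall>b\<in>Basis. Ck_on k (dir_deriv b f) U)"

definition smooth_on :: "('e::euclidean_space \<Rightarrow> 'b::real_normed_vector) \<Rightarrow> 'e set \<Rightarrow> bool" where
  "smooth_on f U \<longleftrightarrow> (\<forall>k. Ck_on k f U)"


section \<open>Closed manifolds\<close>

text \<open>The manifold is the whole type \<open>'m\<close>, given by a smooth atlas (not necessarily maximal);
  its dimension is \<open>CARD('n)\<close>. Connectedness is not required, and second
  countability follows from compactness.\<close>

type_synonym ('m, 'n) chart = "'m set \<times> ('m \<Rightarrow> real^'n)"

abbreviation chart_dom :: "('m, 'n) chart \<Rightarrow> 'm set" where
  "chart_dom c \<equiv> fst c"

abbreviation coord :: "('m, 'n) chart \<Rightarrow> 'm \<Rightarrow> real^'n" where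
  "coord c \<equiv> snd c"

definition chart_inv :: "('m, 'n) chart \<Rightarrow> real^'n \<Rightarrow> 'm" where
  "chart_inv c = inv_into (chart_dom c) (coord c)"

definition chart_img :: "('m, 'n) chart \<Rightarrow> (real^'n) set" where
  "chart_img c = coord c ` chart_dom c"

definition is_chart :: "('m::topological_space, 'n::finite) chart \<Rightarrow> bool" where
  "is_chart c \<longleftrightarrow> open (chart_dom c) \<and> open (chart_img c) \<and>
     homeomorphism (chart_dom c) (chart_img c) (coord c) (chart_inv c)"

definition smooth_closed_manifold :: "('m::t2_space, 'n::finite) chart set \<Rightarrow> bool" where
  "smooth_closed_manifold A \<longleftrightarrow>
     compact (UNIV :: 'm set) \<and>
     (\<forall>c\<in>A. is_chart c) \<and> (\<Union>c\<in>A. chart_dom c) = UNIV \<and>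
     (\<forall>c\<in>A. \<forall>c'\<in>A.
        smooth_on (\<lambda>x. coord c' (chart_inv c x)) (coord c ` (chart_dom c \<inter> chart_dom c')))"

text \<open>A finite set of charts with compact subsets of their images whose interiors cover the
  manifold. Norms of function spaces are taken with respect to a chosen such cover;
  a different choice gives equivalent norms.\<close>

definition adapted_cover ::
  "('m::t2_space, 'n::finite) chart set \<Rightarrow> (('m, 'n) chart \<times> (real^'n) set) set \<Rightarrow> bool" where
  "adapted_cover A C \<longleftrightarrow> finite C \<and>
     (\<forall>(c, K)\<in>C. c \<in> A \<and> compact K \<and> K \<noteq> {} \<and> K \<subseteq> chart_img c) \<and>
     (\<Union>(c, K)\<in>C. chart_inv c ` interior K) = UNIV"

definition the_cover ::
  "('m::t2_space, 'n::finite) chart set \<Rightarrow> (('m, 'n) chart \<times> (real^'n) set) set" where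
  "the_cover A = (SOME C. adapted_cover A C)"

lemma adapted_cover_exists:
  fixes A :: "('m::t2_space, 'n::finite) chart set"
  assumes "smooth_closed_manifold A"
  shows "adapted_cover A (the_cover A)"
proof -
  have cpt: "compact (UNIV :: 'm set)" and ch: "\<And>c. c \<in> A \<Longrightarrow> is_chart c"
    and cov: "(\<Union>c\<in>A. chart_dom c) = UNIV"
    using assms unfolding smooth_closed_manifold_def by auto
  have "\<exists>c K. c \<in> A \<and> compact K \<and> K \<subseteq> chart_img c \<and> p \<in> chart_inv c ` interior K" for p
  proof -
    obtain c where c: "c \<in> A" "p \<in> chart_dom c" using cov by blast
    have ic: "open (chart_img c)"
      "homeomorphism (chart_dom c) (chart_img c) (coord c) (chart_inv c)"
      using ch[OF c(1)] unfolding is_chart_def by auto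
    have "coord c p \<in> chart_img c" using c(2) unfolding chart_img_def by auto
    then obtain r where r: "r > 0" "cball (coord c p) r \<subseteq> chart_img c"
      using ic(1) open_contains_cball by blast
    have "chart_inv c (coord c p) = p" using ic(2) c(2) unfolding homeomorphism_def by auto
    moreover have "coord c p \<in> interior (cball (coord c p) r)"
      using r(1) by (simp add: interior_cball)
    ultimately have "p \<in> chart_inv c ` interior (cball (coord c p) r)"
      by (metis imageI)
    then show ?thesis using c(1) r(2) compact_cball by blast
  qed
  then obtain fc fK where f: "\<And>p. fc p \<in> A" "\<And>p. compact (fK p)"
    "\<And>p. fK p \<subseteq> chart_img (fc p)" "\<And>p. p \<in> chart_inv (fc p) ` interior (fK p)"
    by metis
  have op: "open (chart_inv (fc p) ` interior (fK p))" for p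
  proof -
    have ic: "open (chart_dom (fc p))"
      "homeomorphism (chart_dom (fc p)) (chart_img (fc p)) (coord (fc p)) (chart_inv (fc p))"
      using ch[OF f(1)] unfolding is_chart_def by auto
    have sub: "interior (fK p) \<subseteq> chart_img (fc p)" using f(3) interior_subset by blast
    let ?c = "fc p" and ?I = "interior (fK p)"
    have h: "\<And>q. q \<in> chart_dom ?c \<Longrightarrow> chart_inv ?c (coord ?c q) = q"
      "\<And>x. x \<in> chart_img ?c \<Longrightarrow> coord ?c (chart_inv ?c x) = x"
      "chart_inv ?c ` chart_img ?c = chart_dom ?c" "continuous_on (chart_dom ?c) (coord ?c)"
      using ic(2) unfolding homeomorphism_def by blast+
    have "chart_inv ?c ` ?I = coord ?c -` ?I \<inter> chart_dom ?c"
    proof (intro subset_antisym subsetI)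
      fix q assume "q \<in> chart_inv ?c ` ?I"
      then obtain x where x: "x \<in> ?I" "q = chart_inv ?c x" by blast
      have "x \<in> chart_img ?c" using sub x(1) by (rule subsetD)
      then show "q \<in> coord ?c -` ?I \<inter> chart_dom ?c" using x h(2)[of x] h(3) by auto
    next
      fix q assume "q \<in> coord ?c -` ?I \<inter> chart_dom ?c"
      then show "q \<in> chart_inv ?c ` ?I" using h(1)[of q] by (metis IntD1 IntD2 imageI vimageD)
    qed
    then show ?thesis
      using continuous_on_open_vimage[OF ic(1)] h(4) open_interior by metis
  qed
  have "(UNIV :: 'm set) \<subseteq> (\<Union>p\<in>UNIV. chart_inv (fc p) ` interior (fK p))"
    using f(4) by blast
  then obtain P where P: "finite P" "UNIV \<subseteq> (\<Union>p\<in>P. chart_inv (fc p) ` interior (fK p))"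
    using compactE_image[OF cpt, of UNIV "\<lambda>p. chart_inv (fc p) ` interior (fK p)"] op
    by metis
  have "fK p \<noteq> {}" for p using f(4)[of p] interior_subset by blast
  then have "adapted_cover A ((\<lambda>p. (fc p, fK p)) ` P)"
    using P f unfolding adapted_cover_def by auto
  then show ?thesis unfolding the_cover_def by (rule someI)
qed


section \<open>Hoelder spaces\<close>

definition in_chart :: "('m, 'n) chart \<Rightarrow> ('m \<Rightarrow> 'b) \<Rightarrow> real^'n \<Rightarrow> 'b" where
  "in_chart c f = (\<lambda>x. f (chart_inv c x))"

definition C2a :: "real \<Rightarrow> ('m, 'n::finite) chart set \<Rightarrow> ('m \<Rightarrow> real) set" where
  "C2a \<alpha> A = {f. \<forall>c\<in>A. Ck_on 2 (in_chart c f) (chart_img c) \<and>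
     (\<forall>K. compact K \<and> K \<subseteq> chart_img c \<longrightarrow>
        (\<forall>i j. \<exists>H. \<forall>x\<in>K. \<forall>y\<in>K.
           \<bar>pd i (pd j (in_chart c f)) x - pd i (pd j (in_chart c f)) y\<bar> \<le> H * dist x y powr \<alpha>))}"

definition sup_on :: "'e set \<Rightarrow> ('e \<Rightarrow> real) \<Rightarrow> real" where
  "sup_on K f = (SUP x\<in>K. \<bar>f x\<bar>)"

text \<open>Diagonal pairs contribute \<open>0 / 0 = 0\<close>.\<close>

definition hoelder_seminorm :: "real \<Rightarrow> 'e::metric_space set \<Rightarrow> ('e \<Rightarrow> real) \<Rightarrow> real" where
  "hoelder_seminorm \<alpha> K f = (SUP (x, y)\<in>K \<times> K. \<bar>f x - f y\<bar> / dist x y powr \<alpha>)"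

definition C2a_norm :: "real \<Rightarrow> ('m::t2_space, 'n::finite) chart set \<Rightarrow> ('m \<Rightarrow> real) \<Rightarrow> real" where
  "C2a_norm \<alpha> A f = (\<Sum>(c, K)\<in>the_cover A.
     sup_on K (in_chart c f)
     + (\<Sum>i\<in>UNIV. sup_on K (pd i (in_chart c f)))
     + (\<Sum>i\<in>UNIV. \<Sum>j\<in>UNIV. sup_on K (pd i (pd j (in_chart c f)))
          + hoelder_seminorm \<alpha> K (pd i (pd j (in_chart c f)))))"


section \<open>Riemannian metrics\<close>

text \<open>A metric is given by its coefficient matrices \<open>g c p = (g\<^sub>i\<^sub>j(p))\<close> in the coordinates of
  every chart \<open>c\<close> of the atlas, subject to the tensor transformation law.\<close>

type_synonym ('m, 'n) metric_field = "('m, 'n) chart \<Rightarrow> 'm \<Rightarrow> real^'n^'n"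

definition riemannian_metric ::
  "('m, 'n::finite) chart set \<Rightarrow> ('m, 'n) metric_field \<Rightarrow> bool" where
  "riemannian_metric A g \<longleftrightarrow>
     (\<forall>c\<in>A. smooth_on (in_chart c (g c)) (chart_img c) \<and>
        (\<forall>p\<in>chart_dom c. transpose (g c p) = g c p \<and>
           (\<forall>\<xi>. \<xi> \<noteq> 0 \<longrightarrow> \<xi> \<bullet> (g c p *v \<xi>) > 0))) \<and>
     (\<forall>c\<in>A. \<forall>c'\<in>A. \<forall>p\<in>chart_dom c \<inter> chart_dom c'.
        let J = jacobian (in_chart c (coord c')) (at (coord c p))
        in g c p = transpose J ** g c' p ** J)"

text \<open>The following coordinate expressions take a matrix-valued function \<open>G\<close> on an
  open subset of Euclidean space.\<close>

definition christoffel ::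
  "(real^'n \<Rightarrow> real^'n^'n) \<Rightarrow> 'n::finite \<Rightarrow> 'n \<Rightarrow> 'n \<Rightarrow> real^'n \<Rightarrow> real" where
  "christoffel G k i j x = (1/2) * (\<Sum>l\<in>UNIV. matrix_inv (G x) $ k $ l *
     (pd i (\<lambda>y. G y $ j $ l) x + pd j (\<lambda>y. G y $ i $ l) x - pd l (\<lambda>y. G y $ i $ j) x))"

definition ricci :: "(real^'n \<Rightarrow> real^'n^'n) \<Rightarrow> 'n::finite \<Rightarrow> 'n \<Rightarrow> real^'n \<Rightarrow> real" where
  "ricci G i j x = (\<Sum>k\<in>UNIV.
     pd k (christoffel G k i j) x - pd j (christoffel G k i k) x
     + (\<Sum>l\<in>UNIV. christoffel G k k l x * christoffel G l i j x
                  - christoffel G k j l x * christoffel G l i k x))"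

definition scalar_curv_coord :: "(real^'n \<Rightarrow> real^'n^'n) \<Rightarrow> real^'n::finite \<Rightarrow> real" where
  "scalar_curv_coord G x = (\<Sum>i\<in>UNIV. \<Sum>j\<in>UNIV. matrix_inv (G x) $ i $ j * ricci G i j x)"

definition laplace_coord ::
  "(real^'n \<Rightarrow> real^'n^'n) \<Rightarrow> (real^'n \<Rightarrow> real) \<Rightarrow> real^'n::finite \<Rightarrow> real" where
  "laplace_coord G f x = (\<Sum>i\<in>UNIV. \<Sum>j\<in>UNIV. matrix_inv (G x) $ i $ j *
     (pd i (pd j f) x - (\<Sum>k\<in>UNIV. christoffel G k i j x * pd k f x)))"

text \<open>By invariance under coordinate changes the chart used at a point is immaterial.\<close>

definition chart_at :: "('m, 'n) chart set \<Rightarrow> 'm \<Rightarrow> ('m, 'n) chart" where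
  "chart_at A p = (SOME c. c \<in> A \<and> p \<in> chart_dom c)"

definition scalar_curv ::
  "('m, 'n::finite) chart set \<Rightarrow> ('m, 'n) metric_field \<Rightarrow> 'm \<Rightarrow> real" where
  "scalar_curv A g p = (let c = chart_at A p in scalar_curv_coord (in_chart c (g c)) (coord c p))"

definition laplacian ::
  "('m, 'n::finite) chart set \<Rightarrow> ('m, 'n) metric_field \<Rightarrow> ('m \<Rightarrow> real) \<Rightarrow> 'm \<Rightarrow> real" where
  "laplacian A g f p =
     (let c = chart_at A p in laplace_coord (in_chart c (g c)) (in_chart c f) (coord c p))"

text \<open>The Riemannian measure is glued from the local densities \<open>sqrt (det (g\<^sub>i\<^sub>j)) dx\<close> with the Borel
  partition of unity whose member for the chart \<open>c\<close> of a finite subatlas is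
  \<open>1 / multiplicity\<close> on the domain of \<open>c\<close> and \<open>0\<close> elsewhere, the multiplicity of a point being the
  number of charts of the subatlas around it.\<close>

definition finite_subatlas :: "('m::t2_space, 'n::finite) chart set \<Rightarrow> ('m, 'n) chart set" where
  "finite_subatlas A = fst ` the_cover A"

definition chart_multiplicity :: "('m::t2_space, 'n::finite) chart set \<Rightarrow> 'm \<Rightarrow> nat" where
  "chart_multiplicity A p = card {c \<in> finite_subatlas A. p \<in> chart_dom c}"

definition riem_measure ::
  "('m::t2_space, 'n::finite) chart set \<Rightarrow> ('m, 'n) metric_field \<Rightarrow> 'm measure" where
  "riem_measure A g = measure_of UNIV (sets borel) (\<lambda>E. \<Sum>c\<in>finite_subatlas A.
     \<integral>\<^sup>+x\<in>coord c ` (E \<inter> chart_dom c).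
       ennreal (sqrt (det (in_chart c (g c) x)) / real (in_chart c (chart_multiplicity A) x))
     \<partial>lborel)"

definition riem_volume :: "('m::t2_space, 'n::finite) chart set \<Rightarrow> ('m, 'n) metric_field \<Rightarrow> real" where
  "riem_volume A g = measure (riem_measure A g) UNIV"

definition L2_inner :: "('m::t2_space, 'n::finite) chart set \<Rightarrow> ('m, 'n) metric_field \<Rightarrow>
    ('m \<Rightarrow> real) \<Rightarrow> ('m \<Rightarrow> real) \<Rightarrow> real" where
  "L2_inner A g u v = (\<integral>p. u p * v p \<partial>riem_measure A g)"

definition L2_norm :: "('m::t2_space, 'n::finite) chart set \<Rightarrow> ('m, 'n) metric_field \<Rightarrow>
    ('m \<Rightarrow> real) \<Rightarrow> real" where
  "L2_norm A g u = sqrt (L2_inner A g u u)"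


section \<open>The Yamabe functional on a unit volume conformal class\<close>

definition crit_exp :: "'n::finite itself \<Rightarrow> real" where
  "crit_exp _ = 2 * real CARD('n) / (real CARD('n) - 2)"

definition yamabe :: "('m::t2_space, 'n::finite) chart set \<Rightarrow> ('m, 'n) metric_field \<Rightarrow> real" where
  "yamabe A g = riem_volume A g powr (- 2 / crit_exp TYPE('n)) *
     (\<integral>p. scalar_curv A g p \<partial>riem_measure A g)"

definition conformal :: "('m \<Rightarrow> real) \<Rightarrow> ('m, 'n::finite) metric_field \<Rightarrow> ('m, 'n) metric_field" where
  "conformal w g = (\<lambda>c p. (w p powr (crit_exp TYPE('n) - 2)) *\<^sub>R g c p)"

text \<open>A metric \<open>w\<^sup>N\<^sup>-\<^sup>2 g\<close> of the class is identified with its conformal factor \<open>w\<close>.\<close>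

definition conf_class :: "real \<Rightarrow> ('m::t2_space, 'n::finite) chart set \<Rightarrow> ('m, 'n) metric_field \<Rightarrow>
    ('m \<Rightarrow> real) set" where
  "conf_class \<alpha> A g = {w \<in> C2a \<alpha> A. (\<forall>p. w p > 0) \<and>
     (\<integral>p. w p powr crit_exp TYPE('n) \<partial>riem_measure A g) = 1}"

definition yamabe_conf :: "('m::t2_space, 'n::finite) chart set \<Rightarrow> ('m, 'n) metric_field \<Rightarrow>
    ('m \<Rightarrow> real) \<Rightarrow> real" where
  "yamabe_conf A g w = yamabe A (conformal w g)"

definition constant_scalar_curv ::
  "('m, 'n::finite) chart set \<Rightarrow> ('m, 'n) metric_field \<Rightarrow> bool" where
  "constant_scalar_curv A g \<longleftrightarrow> (\<exists>\<kappa>. \<forall>p. scalar_curv A g p = \<kappa>)"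

definition CSC1 :: "real \<Rightarrow> ('m::t2_space, 'n::finite) chart set \<Rightarrow> ('m, 'n) metric_field \<Rightarrow>
    ('m \<Rightarrow> real) set" where
  "CSC1 \<alpha> A g = {w \<in> conf_class \<alpha> A g. constant_scalar_curv A (conformal w g)}"

definition strict_local_min ::
  "real \<Rightarrow> ('m::t2_space, 'n::finite) chart set \<Rightarrow> ('m, 'n) metric_field \<Rightarrow> bool" where
  "strict_local_min \<alpha> A g \<longleftrightarrow> (\<exists>\<delta>>0. \<forall>w\<in>conf_class \<alpha> A g.
     w \<noteq> (\<lambda>_. 1) \<and> C2a_norm \<alpha> A (\<lambda>p. w p - 1) < \<delta> \<longrightarrow>
     yamabe_conf A g w > yamabe_conf A g (\<lambda>_. 1))"


section \<open>Linearized operator and integrability\<close>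

definition lin_yamabe :: "('m, 'n::finite) chart set \<Rightarrow> ('m, 'n) metric_field \<Rightarrow>
    ('m \<Rightarrow> real) \<Rightarrow> 'm \<Rightarrow> real" where
  "lin_yamabe A g v p = (real CARD('n) - 1) * laplacian A g v p + scalar_curv A g p * v p"

text \<open>By elliptic regularity it does not matter in which function space the kernel is taken.\<close>

definition Lambda0 :: "real \<Rightarrow> ('m::t2_space, 'n::finite) chart set \<Rightarrow> ('m, 'n) metric_field \<Rightarrow>
    ('m \<Rightarrow> real) set" where
  "Lambda0 \<alpha> A g = {v \<in> C2a \<alpha> A. (\<forall>p. lin_yamabe A g v p = 0) \<and> (\<integral>p. v p \<partial>riem_measure A g) = 0}"

definition C2a_perp :: "real \<Rightarrow> ('m::t2_space, 'n::finite) chart set \<Rightarrow> ('m, 'n) metric_field \<Rightarrow>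
    ('m \<Rightarrow> real) set" where
  "C2a_perp \<alpha> A g = {f \<in> C2a \<alpha> A. \<forall>v\<in>Lambda0 \<alpha> A g. L2_inner A g f v = 0}"

definition degenerate ::
  "real \<Rightarrow> ('m::t2_space, 'n::finite) chart set \<Rightarrow> ('m, 'n) metric_field \<Rightarrow> bool" where
  "degenerate \<alpha> A g \<longleftrightarrow> Lambda0 \<alpha> A g \<noteq> {\<lambda>_. 0}"

definition integrable_metric ::
  "real \<Rightarrow> ('m::t2_space, 'n::finite) chart set \<Rightarrow> ('m, 'n) metric_field \<Rightarrow> bool" where
  "integrable_metric \<alpha> A g \<longleftrightarrow> (\<forall>v\<in>Lambda0 \<alpha> A g. \<exists>\<epsilon>>0. \<exists>w :: real \<Rightarrow> 'm \<Rightarrow> real.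
     (\<forall>c\<in>A. Ck_on 2 (\<lambda>(t, x). in_chart c (w t) x) ({-\<epsilon><..<\<epsilon>} \<times> chart_img c)) \<and>
     (\<forall>t\<in>{-\<epsilon><..<\<epsilon>}. w t \<in> CSC1 \<alpha> A g) \<and>
     w 0 = (\<lambda>_. 1) \<and>
     (\<forall>p. ((\<lambda>t. w t p) has_real_derivative v p) (at 0)))"


section \<open>Polynomials and analytic maps on the kernel\<close>

text \<open>\<open>e 0, \<dots>, e (d - 1)\<close> is an \<open>L\<^sup>2\<close>-orthonormal basis of the kernel; multi-indices in \<open>d\<close> variables
  are functions on \<open>nat\<close> vanishing from \<open>d\<close> on.\<close>

definition kernel_basis :: "real \<Rightarrow> ('m::t2_space, 'n::finite) chart set \<Rightarrow> ('m, 'n) metric_field \<Rightarrow>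
    nat \<Rightarrow> (nat \<Rightarrow> 'm \<Rightarrow> real) \<Rightarrow> bool" where
  "kernel_basis \<alpha> A g d e \<longleftrightarrow>
     (\<forall>i<d. \<forall>j<d. L2_inner A g (e i) (e j) = (if i = j then 1 else 0)) \<and>
     Lambda0 \<alpha> A g = range (\<lambda>x :: nat \<Rightarrow> real. \<lambda>p. \<Sum>i<d. x i * e i p)"

definition multi_indices :: "nat \<Rightarrow> (nat \<Rightarrow> nat) set" where
  "multi_indices d = {\<beta>. \<forall>i\<ge>d. \<beta> i = 0}"

definition mi_order :: "nat \<Rightarrow> (nat \<Rightarrow> nat) \<Rightarrow> nat" where
  "mi_order d \<beta> = (\<Sum>i<d. \<beta> i)"

definition monomial :: "nat \<Rightarrow> (nat \<Rightarrow> nat) \<Rightarrow> (nat \<Rightarrow> real) \<Rightarrow> real" where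
  "monomial d \<beta> x = (\<Prod>i<d. x i ^ \<beta> i)"

definition homogeneous_poly :: "real \<Rightarrow> ('m::t2_space, 'n::finite) chart set \<Rightarrow>
    ('m, 'n) metric_field \<Rightarrow> nat \<Rightarrow> (('m \<Rightarrow> real) \<Rightarrow> real) \<Rightarrow> bool" where
  "homogeneous_poly \<alpha> A g j Q \<longleftrightarrow> (\<exists>d e a. kernel_basis \<alpha> A g d e \<and>
     (\<forall>v\<in>Lambda0 \<alpha> A g. Q v = (\<Sum>\<beta> | \<beta> \<in> multi_indices d \<and> mi_order d \<beta> = j.
        a \<beta> * monomial d \<beta> (\<lambda>i. L2_inner A g v (e i)))))"

definition kernel_ball :: "real \<Rightarrow> ('m::t2_space, 'n::finite) chart set \<Rightarrow>
    ('m, 'n) metric_field \<Rightarrow> real \<Rightarrow> ('m \<Rightarrow> real) set" where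
  "kernel_ball \<alpha> A g \<epsilon> = {v \<in> Lambda0 \<alpha> A g. L2_norm A g v < \<epsilon>}"

text \<open>Analyticity as a map into the Banach space \<open>C\<^sup>2\<^sup>,\<^sup>\<alpha>\<close>: around every point, \<open>\<Phi>\<close> is given by a
  power series with coefficients \<open>a \<beta>\<close> in \<open>C\<^sup>2\<^sup>,\<^sup>\<alpha>\<close> that converges absolutely in the
  \<open>C\<^sup>2\<^sup>,\<^sup>\<alpha>\<close>-norm on a polydisc of radius \<open>r\<close>; the sum can then be evaluated pointwise.\<close>

definition analytic_to_C2a :: "real \<Rightarrow> ('m::t2_space, 'n::finite) chart set \<Rightarrow>
    ('m, 'n) metric_field \<Rightarrow> real \<Rightarrow> (('m \<Rightarrow> real) \<Rightarrow> ('m \<Rightarrow> real)) \<Rightarrow> bool" where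
  "analytic_to_C2a \<alpha> A g \<epsilon> \<Phi> \<longleftrightarrow> (\<exists>d e. kernel_basis \<alpha> A g d e \<and>
     (\<forall>v\<in>kernel_ball \<alpha> A g \<epsilon>. \<exists>r>0. \<exists>a :: (nat \<Rightarrow> nat) \<Rightarrow> 'm \<Rightarrow> real.
        (\<forall>\<beta>\<in>multi_indices d. a \<beta> \<in> C2a \<alpha> A) \<and>
        (\<lambda>\<beta>. C2a_norm \<alpha> A (a \<beta>) * r ^ mi_order d \<beta>) summable_on multi_indices d \<and>
        (\<forall>x. (\<forall>i<d. \<bar>x i\<bar> < r) \<longrightarrow>
           (let u = (\<lambda>p. v p + (\<Sum>i<d. x i * e i p))
            in u \<in> kernel_ball \<alpha> A g \<epsilon> \<longrightarrow>
               (\<forall>p. ((\<lambda>\<beta>. monomial d \<beta> x * a \<beta> p) has_sum \<Phi> u p) (multi_indices d))))))"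


section \<open>Lyapunov--Schmidt reduction and order of integrability\<close>

definition LS_map :: "(('m \<Rightarrow> real) \<Rightarrow> ('m \<Rightarrow> real)) \<Rightarrow> ('m \<Rightarrow> real) \<Rightarrow> 'm \<Rightarrow> real" where
  "LS_map \<Phi> v = (\<lambda>p. 1 + v p + \<Phi> v p)"

text \<open>The Yamabe functional is defined for all positive conformal factors near \<open>\<Psi>(v)\<close>, so its
  differential in a direction tangent to the unit volume class is computed along straight lines.\<close>

definition LS_reduction :: "real \<Rightarrow> ('m::t2_space, 'n::finite) chart set \<Rightarrow>
    ('m, 'n) metric_field \<Rightarrow> real \<Rightarrow> (('m \<Rightarrow> real) \<Rightarrow> ('m \<Rightarrow> real)) \<Rightarrow> bool" where
  "LS_reduction \<alpha> A g \<epsilon> \<Phi> \<longleftrightarrow> \<epsilon> > 0 \<and>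
     analytic_to_C2a \<alpha> A g \<epsilon> \<Phi> \<and>
     \<Phi> (\<lambda>_. 0) = (\<lambda>_. 0) \<and>
     (\<forall>\<eta>>0. \<exists>\<delta>>0. \<forall>v\<in>kernel_ball \<alpha> A g \<epsilon>. L2_norm A g v < \<delta> \<longrightarrow>
        C2a_norm \<alpha> A (\<Phi> v) \<le> \<eta> * L2_norm A g v) \<and>
     (\<forall>v\<in>kernel_ball \<alpha> A g \<epsilon>.
        \<Phi> v \<in> C2a_perp \<alpha> A g \<and>
        LS_map \<Phi> v \<in> conf_class \<alpha> A g \<and>
        (\<forall>\<zeta>\<in>C2a_perp \<alpha> A g.
           (\<integral>p. LS_map \<Phi> v p powr (crit_exp TYPE('n) - 1) * \<zeta> p \<partial>riem_measure A g) = 0 \<longrightarrow>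
           ((\<lambda>t. yamabe_conf A g (\<lambda>p. LS_map \<Phi> v p + t * \<zeta> p)) has_real_derivative 0) (at 0)))"

definition reduced_functional :: "('m::t2_space, 'n::finite) chart set \<Rightarrow>
    ('m, 'n) metric_field \<Rightarrow> (('m \<Rightarrow> real) \<Rightarrow> ('m \<Rightarrow> real)) \<Rightarrow> ('m \<Rightarrow> real) \<Rightarrow> real" where
  "reduced_functional A g \<Phi> v = yamabe_conf A g (LS_map \<Phi> v)"

text \<open>\<open>F(v) = F(0) + \<Sum>\<^sub>j\<^sub>\<ge>\<^sub>p Q\<^sub>j(v)\<close> near \<open>0\<close> with \<open>Q\<^sub>p\<close> not identically \<open>0\<close>. The \<open>Q\<^sub>j\<close> and \<open>p\<close> are
  uniquely determined (restrict to rays).\<close>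

definition leading_expansion :: "real \<Rightarrow> ('m::t2_space, 'n::finite) chart set \<Rightarrow>
    ('m, 'n) metric_field \<Rightarrow> (('m \<Rightarrow> real) \<Rightarrow> real) \<Rightarrow> nat \<Rightarrow> (nat \<Rightarrow> ('m \<Rightarrow> real) \<Rightarrow> real) \<Rightarrow> bool" where
  "leading_expansion \<alpha> A g F p Q \<longleftrightarrow>
     (\<forall>j\<ge>p. homogeneous_poly \<alpha> A g j (Q j)) \<and>
     (\<exists>v\<in>Lambda0 \<alpha> A g. Q p v \<noteq> 0) \<and>
     (\<exists>r>0. \<forall>v\<in>kernel_ball \<alpha> A g r. (\<lambda>k. Q (p + k) v) sums (F v - F (\<lambda>_. 0)))"

text \<open>The order of integrability is an invariant of non-integrable metrics. Analytically,
  non-integrability is equivalent to the reduced functional not being constant near \<open>0\<close>. The germ of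
  \<open>\<Phi>\<close> at \<open>0\<close> is unique, so the existential quantifiers merely name the reduction.\<close>

definition has_order_of_integrability ::
  "real \<Rightarrow> ('m::t2_space, 'n::finite) chart set \<Rightarrow> ('m, 'n) metric_field \<Rightarrow> nat \<Rightarrow> bool" where
  "has_order_of_integrability \<alpha> A g p \<longleftrightarrow> \<not> integrable_metric \<alpha> A g \<and>
     (\<exists>\<epsilon> \<Phi> Q. LS_reduction \<alpha> A g \<epsilon> \<Phi> \<and>
        leading_expansion \<alpha> A g (reduced_functional A g \<Phi>) p Q)"

definition kernel_sphere :: "real \<Rightarrow> ('m::t2_space, 'n::finite) chart set \<Rightarrow>
    ('m, 'n) metric_field \<Rightarrow> ('m \<Rightarrow> real) set" where
  "kernel_sphere \<alpha> A g = {v \<in> Lambda0 \<alpha> A g. L2_norm A g v = 1}"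

definition AS_condition ::
  "real \<Rightarrow> ('m::t2_space, 'n::finite) chart set \<Rightarrow> ('m, 'n) metric_field \<Rightarrow> nat \<Rightarrow> bool" where
  "AS_condition \<alpha> A g p \<longleftrightarrow> \<not> integrable_metric \<alpha> A g \<and>
     (\<exists>\<epsilon> \<Phi> Q. LS_reduction \<alpha> A g \<epsilon> \<Phi> \<and>
        leading_expansion \<alpha> A g (reduced_functional A g \<Phi>) p Q \<and>
        (\<exists>v\<in>kernel_sphere \<alpha> A g. Q p v > 0 \<and> (\<forall>u\<in>kernel_sphere \<alpha> A g. Q p u \<le> Q p v)))"

end

theory Submission
  imports Defs
begin

text \<open>
  Let \<open>F(v) = Y(1 + v + \<Phi>(v))\<close> be the reduced functional on the finite-dimensional kernel
  \<open>\<Lambda>\<^sub>0\<close>. Strict minimality makes \<open>0\<close> a local minimum of \<open>F\<close> along every ray, and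
  this determines the sign of the leading term. Indeed, for \<open>v \<in> \<Lambda>\<^sub>0\<close> the conformal factors
  \<open>1 + t v + \<Phi>(t v)\<close> lie in the unit volume conformal class and tend to \<open>1\<close> in \<open>C\<^sup>2\<^sup>,\<^sup>\<alpha>\<close>
  as \<open>t\<close> tends to \<open>0\<close>, because \<open>\<Phi>(t v) = o(t)\<close>. Hence \<open>F(t v) \<ge> F(0)\<close> for small \<open>t > 0\<close>
  (\<open>reduced_functional_ray_min\<close>).

  On the ray, homogeneity turns the expansion of \<open>F\<close> into the power series
  \<open>F(t v) - F(0) = t\<^sup>p (F\<^sub>p(v) + t F\<^sub>p\<^sub>+\<^sub>1(v) + \<dots>)\<close>. Dividing by \<open>t\<^sup>p\<close> and letting
  \<open>t\<close> decrease to \<open>0\<close> gives \<open>F\<^sub>p(v) \<ge> 0\<close> (\<open>leading_term_nonneg\<close>). As \<open>F\<^sub>p\<close> is nonnegative but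
  not identically zero, it is positive somewhere, and by homogeneity somewhere on the unit sphere
  of \<open>\<Lambda>\<^sub>0\<close> (\<open>homogeneous_poly_normalize\<close>). That sphere is compact, so the maximum of \<open>F\<^sub>p\<close>
  on it is attained (\<open>homogeneous_poly_attains_max\<close>), and it is positive.

  Two pieces of analysis support this. The convergence to \<open>1\<close> uses that the \<open>C\<^sup>2\<^sup>,\<^sup>\<alpha>\<close>-norm,
  defined through suprema over compact sets in charts, is subadditive and
  homogeneous (\<open>C2a_norm_lincomb_le\<close>). The compactness uses that an \<open>L\<^sup>2\<close>-orthonormal basis of \<open>\<Lambda>\<^sub>0\<close>
  identifies the \<open>L\<^sup>2\<close>-norm with the Euclidean norm of the coordinates
  (\<open>L2_inner_kernel_vec\<close>), which depends on bilinearity of the inner product and therefore on the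
  integrability of products of \<open>C\<^sup>2\<^sup>,\<^sup>\<alpha>\<close> functions.
\<close>

section \<open>The Hoelder norm of a linear combination\<close>

lemma dir_deriv_lincomb:
  fixes f h :: "'e::euclidean_space \<Rightarrow> real"
  assumes "f differentiable at x" "h differentiable at x"
  shows "dir_deriv b (\<lambda>y. t * f y + h y) x = t * dir_deriv b f x + dir_deriv b h x"
proof -
  have "((\<lambda>y. t * f y + h y) has_derivative
      (\<lambda>y. t * frechet_derivative f (at x) y + frechet_derivative h (at x) y)) (at x)"
    using assms by (intro has_derivative_add has_derivative_mult_right)
      (simp_all flip: frechet_derivative_works)
  then show ?thesis
    unfolding dir_deriv_def by (simp add: frechet_derivative_at[symmetric])
qed

lemma Ck_on_2D:
  assumes "Ck_on 2 (f :: real^'n \<Rightarrow> real) (U :: (real^'n::finite) set)" "open U"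
  shows "\<And>x. x \<in> U \<Longrightarrow> f differentiable at x"
    and "\<And>j x. x \<in> U \<Longrightarrow> pd j f differentiable at x"
    and "continuous_on U f"
    and "\<And>j. continuous_on U (pd j f)"
    and "\<And>i j. continuous_on U (pd i (pd j f))"
proof -
  have ax: "axis i (1::real) \<in> Basis" for i :: 'n
    by (simp add: axis_in_Basis_iff)
  show d1: "\<And>x. x \<in> U \<Longrightarrow> f differentiable at x"
    using assms(1) by (simp add: numeral_2_eq_2)
  show d2: "\<And>j x. x \<in> U \<Longrightarrow> pd j f differentiable at x"
    using assms(1) ax by (simp add: numeral_2_eq_2)
  show "\<And>i j. continuous_on U (pd i (pd j f))"
    using assms(1) ax by (simp add: numeral_2_eq_2)
  show "continuous_on U f" "\<And>j. continuous_on U (pd j f)"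
    using d1 d2 by (auto intro!: continuous_at_imp_continuous_on differentiable_imp_continuous_within)
qed

lemma pd_lincomb:
  fixes f h :: "real^'n::finite \<Rightarrow> real"
  assumes "Ck_on 2 f U" "Ck_on 2 h U" "open U" "x \<in> U"
  shows "pd j (\<lambda>y. t * f y + h y) x = t * pd j f x + pd j h x"
  using assms by (intro dir_deriv_lincomb) (auto dest: Ck_on_2D(1))

text \<open>The first-order formula holds only on \<open>U\<close>, so the two first derivatives need not agree as
  functions; since \<open>U\<close> is open, their germs at \<open>x\<close> do.\<close>

lemma pd_pd_lincomb:
  fixes f h :: "real^'n::finite \<Rightarrow> real"
  assumes "Ck_on 2 f U" "Ck_on 2 h U" "open U" "x \<in> U"
  shows "pd i (pd j (\<lambda>y. t * f y + h y)) x = t * pd i (pd j f) x + pd i (pd j h) x"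
proof -
  have d: "pd j f differentiable at x" "pd j h differentiable at x"
    using Ck_on_2D(2)[OF assms(1,3,4)] Ck_on_2D(2)[OF assms(2,3,4)] by auto
  have "frechet_derivative (pd j (\<lambda>y. t * f y + h y)) (at x)
      = frechet_derivative (\<lambda>y. t * pd j f y + pd j h y) (at x)"
    by (rule frechet_derivative_transform_within_open[symmetric, OF _ assms(3,4)])
       (use d in \<open>auto intro!: derivative_intros simp: pd_lincomb[OF assms(1-3)]\<close>)
  then have "pd i (pd j (\<lambda>y. t * f y + h y)) x = pd i (\<lambda>y. t * pd j f y + pd j h y) x"
    by (simp add: dir_deriv_def)
  then show ?thesis using dir_deriv_lincomb[OF d] by simp
qed

text \<open>Real suprema of unbounded sets are unspecified, so every triangle inequality below first needs
  boundedness: from compactness for the sup norms, from the Hoelder condition for the seminorms.\<close>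

lemma SUP_lincomb_le:
  fixes f h k :: "'i \<Rightarrow> real"
  assumes "I \<noteq> {}" "bdd_above (f ` I)" "bdd_above (h ` I)" "0 \<le> t"
    and "\<And>x. x \<in> I \<Longrightarrow> k x \<le> t * f x + h x"
  shows "(SUP x\<in>I. k x) \<le> t * (SUP x\<in>I. f x) + (SUP x\<in>I. h x)"
proof (rule cSUP_least[OF assms(1)])
  fix x assume x: "x \<in> I"
  have "f x \<le> (SUP x\<in>I. f x)" "h x \<le> (SUP x\<in>I. h x)"
    using x assms by (auto intro: cSUP_upper)
  then have "t * f x + h x \<le> t * (SUP x\<in>I. f x) + (SUP x\<in>I. h x)"
    using assms(4) by (intro add_mono mult_left_mono)
  then show "k x \<le> \<dots>" using assms(5)[OF x] by linarith
qed

lemma sup_on_lincomb_le: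
  assumes "compact (K :: 'e::topological_space set)" "K \<noteq> {}" "continuous_on K f" "continuous_on K h"
    and "\<And>x. x \<in> K \<Longrightarrow> k x = t * f x + h x"
  shows "sup_on K k \<le> \<bar>t\<bar> * sup_on K f + sup_on K h"
proof -
  have bdd: "bdd_above ((\<lambda>x. \<bar>q x\<bar>) ` K)" if "continuous_on K q" for q :: "'e \<Rightarrow> real"
  proof -
    have "compact ((\<lambda>x. \<bar>q x\<bar>) ` K)"
      using that assms(1) by (intro compact_continuous_image continuous_intros)
    then show ?thesis by (intro bounded_imp_bdd_above compact_imp_bounded)
  qed
  show ?thesis unfolding sup_on_def
    by (rule SUP_lincomb_le)
       (use assms bdd in \<open>auto simp flip: abs_mult\<close>)
qed

lemma hoelder_seminorm_lincomb_le:
  assumes "K \<noteq> {}"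
    and "\<exists>H. \<forall>x\<in>K. \<forall>y\<in>K. \<bar>f x - f y\<bar> \<le> H * dist x y powr \<alpha>"
    and "\<exists>H. \<forall>x\<in>K. \<forall>y\<in>K. \<bar>h x - h y\<bar> \<le> H * dist x y powr \<alpha>"
    and "\<And>x. x \<in> K \<Longrightarrow> k x = t * f x + h x"
  shows "hoelder_seminorm \<alpha> K k \<le> \<bar>t\<bar> * hoelder_seminorm \<alpha> K f + hoelder_seminorm \<alpha> K h"
proof -
  have bdd: "bdd_above ((\<lambda>(x, y). \<bar>q x - q y\<bar> / dist x y powr \<alpha>) ` (K \<times> K))"
    if q: "\<exists>H. \<forall>x\<in>K. \<forall>y\<in>K. \<bar>q x - q y\<bar> \<le> H * dist x y powr \<alpha>" for q
  proof -
    obtain H where H: "\<And>x y. x \<in> K \<Longrightarrow> y \<in> K \<Longrightarrow> \<bar>q x - q y\<bar> \<le> H * dist x y powr \<alpha>"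
      using q by blast
    \<comment> \<open>The constant \<open>H\<close> may be negative if \<open>K\<close> is a single point, where the quotient is \<open>0 / 0 = 0\<close>.\<close>
    have "\<bar>q x - q y\<bar> / dist x y powr \<alpha> \<le> max H 0" if xy: "x \<in> K" "y \<in> K" for x y
    proof (cases "x = y")
      case False
      then have "\<bar>q x - q y\<bar> / dist x y powr \<alpha> \<le> H"
        using H[OF xy] by (simp add: divide_le_eq)
      then show ?thesis by linarith
    qed simp
    then show ?thesis by (intro bdd_aboveI[of _ "max H 0"]) auto
  qed
  show ?thesis unfolding hoelder_seminorm_def
  proof (rule SUP_lincomb_le)
    fix z assume "z \<in> K \<times> K"
    then obtain x y where z: "z = (x, y)" "x \<in> K" "y \<in> K" by auto
    have "\<bar>k x - k y\<bar> = \<bar>t * (f x - f y) + (h x - h y)\<bar>"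
      using z assms(4) by (simp add: algebra_simps)
    also have "\<dots> \<le> \<bar>t\<bar> * \<bar>f x - f y\<bar> + \<bar>h x - h y\<bar>"
      by (metis abs_mult abs_triangle_ineq)
    finally have "\<bar>k x - k y\<bar> / dist x y powr \<alpha>
        \<le> (\<bar>t\<bar> * \<bar>f x - f y\<bar> + \<bar>h x - h y\<bar>) / dist x y powr \<alpha>"
      by (rule divide_right_mono) simp
    then show "(case z of (x, y) \<Rightarrow> \<bar>k x - k y\<bar> / dist x y powr \<alpha>)
        \<le> \<bar>t\<bar> * (case z of (x, y) \<Rightarrow> \<bar>f x - f y\<bar> / dist x y powr \<alpha>)
          + (case z of (x, y) \<Rightarrow> \<bar>h x - h y\<bar> / dist x y powr \<alpha>)"
      by (simp add: z(1) add_divide_distrib)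
  qed (use assms bdd in auto)
qed

lemma C2a_norm_lincomb_le:
  fixes A :: "('m::t2_space, 'n::finite) chart set"
  assumes "smooth_closed_manifold A" "u \<in> C2a \<alpha> A" "v \<in> C2a \<alpha> A"
  shows "C2a_norm \<alpha> A (\<lambda>p. t * u p + v p) \<le> \<bar>t\<bar> * C2a_norm \<alpha> A u + C2a_norm \<alpha> A v"
proof -
  have cov: "adapted_cover A (the_cover A)" by (rule adapted_cover_exists[OF assms(1)])
  define N where "N = (\<lambda>(c :: ('m,'n) chart, K) f. sup_on K (in_chart c f)
     + (\<Sum>i\<in>UNIV. sup_on K (pd i (in_chart c f)))
     + (\<Sum>i\<in>UNIV. \<Sum>j\<in>UNIV. sup_on K (pd i (pd j (in_chart c f)))
          + hoelder_seminorm \<alpha> K (pd i (pd j (in_chart c f)))))"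
  have N: "C2a_norm \<alpha> A f = (\<Sum>z\<in>the_cover A. N z f)" for f
    unfolding C2a_norm_def N_def by (intro sum.cong) auto
  have "N z (\<lambda>p. t * u p + v p) \<le> \<bar>t\<bar> * N z u + N z v" if z: "z \<in> the_cover A" for z
  proof -
    obtain c K where cK: "z = (c, K)" by (cases z)
    have c: "c \<in> A" and K: "compact K" "K \<noteq> {}" "K \<subseteq> chart_img c"
      using cov z unfolding adapted_cover_def cK by auto
    have op: "open (chart_img c)"
      using assms(1) c unfolding smooth_closed_manifold_def is_chart_def by blast
    define f h where "f = in_chart c u" and "h = in_chart c v"
    have w: "in_chart c (\<lambda>p. t * u p + v p) = (\<lambda>x. t * f x + h x)"
      by (simp add: in_chart_def f_def h_def)
    have f: "Ck_on 2 f (chart_img c)" and h: "Ck_on 2 h (chart_img c)"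
      using assms(2,3) c unfolding C2a_def f_def h_def by auto
    have fH: "\<exists>H. \<forall>x\<in>K. \<forall>y\<in>K. \<bar>pd i (pd j f) x - pd i (pd j f) y\<bar> \<le> H * dist x y powr \<alpha>" for i j
      using assms(2) c K unfolding C2a_def f_def by blast
    have hH: "\<exists>H. \<forall>x\<in>K. \<forall>y\<in>K. \<bar>pd i (pd j h) x - pd i (pd j h) y\<bar> \<le> H * dist x y powr \<alpha>" for i j
      using assms(3) c K unfolding C2a_def h_def by blast
    have inU: "x \<in> K \<Longrightarrow> x \<in> chart_img c" for x using K by blast
    note fc = Ck_on_2D(3-5)[OF f op, THEN continuous_on_subset, OF K(3)]
    note hc = Ck_on_2D(3-5)[OF h op, THEN continuous_on_subset, OF K(3)]
    let ?w = "\<lambda>x. t * f x + h x"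
    have 0: "sup_on K ?w \<le> \<bar>t\<bar> * sup_on K f + sup_on K h"
      by (rule sup_on_lincomb_le[OF K(1,2) fc(1) hc(1)]) simp
    have 1: "sup_on K (pd i ?w) \<le> \<bar>t\<bar> * sup_on K (pd i f) + sup_on K (pd i h)" for i
      by (rule sup_on_lincomb_le[OF K(1,2) fc(2) hc(2)]) (rule pd_lincomb[OF f h op inU])
    have 2: "sup_on K (pd i (pd j ?w))
        \<le> \<bar>t\<bar> * sup_on K (pd i (pd j f)) + sup_on K (pd i (pd j h))" for i j
      by (rule sup_on_lincomb_le[OF K(1,2) fc(3) hc(3)]) (rule pd_pd_lincomb[OF f h op inU])
    have 3: "hoelder_seminorm \<alpha> K (pd i (pd j ?w))
        \<le> \<bar>t\<bar> * hoelder_seminorm \<alpha> K (pd i (pd j f)) + hoelder_seminorm \<alpha> K (pd i (pd j h))" for i j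
      by (rule hoelder_seminorm_lincomb_le[OF K(2) fH hH]) (rule pd_pd_lincomb[OF f h op inU])
    have s1: "(\<Sum>i\<in>UNIV. sup_on K (pd i ?w))
        \<le> (\<Sum>i\<in>UNIV. \<bar>t\<bar> * sup_on K (pd i f) + sup_on K (pd i h))"
      by (rule sum_mono) (rule 1)
    have s2: "(\<Sum>i\<in>UNIV. \<Sum>j\<in>UNIV. sup_on K (pd i (pd j ?w)) + hoelder_seminorm \<alpha> K (pd i (pd j ?w)))
        \<le> (\<Sum>i\<in>UNIV. \<Sum>j\<in>UNIV.
          (\<bar>t\<bar> * sup_on K (pd i (pd j f)) + sup_on K (pd i (pd j h)))
          + (\<bar>t\<bar> * hoelder_seminorm \<alpha> K (pd i (pd j f)) + hoelder_seminorm \<alpha> K (pd i (pd j h))))"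
      by (intro sum_mono add_mono 2 3)
    show ?thesis
      using add_mono[OF add_mono[OF 0 s1] s2]
      by (simp add: N_def cK w flip: f_def h_def)
         (simp add: sum.distrib sum_distrib_left algebra_simps)
  qed
  then have "C2a_norm \<alpha> A (\<lambda>p. t * u p + v p) \<le> (\<Sum>z\<in>the_cover A. \<bar>t\<bar> * N z u + N z v)"
    unfolding N by (rule sum_mono)
  then show ?thesis unfolding N by (simp add: sum.distrib sum_distrib_left)
qed

section \<open>Coordinates on the kernel\<close>

lemma continuous_C2a:
  fixes A :: "('m::t2_space, 'n::finite) chart set"
  assumes "smooth_closed_manifold A" "u \<in> C2a \<alpha> A"
  shows "continuous_on UNIV u"
proof -
  have "continuous_on (chart_dom c) u" if c: "c \<in> A" for c
  proof -
    have ic: "open (chart_img c)"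
      "homeomorphism (chart_dom c) (chart_img c) (coord c) (chart_inv c)"
      using assms(1) c unfolding smooth_closed_manifold_def is_chart_def by blast+
    have "Ck_on 2 (in_chart c u) (chart_img c)"
      using assms(2) c unfolding C2a_def by blast
    then have "continuous_on (chart_img c) (in_chart c u)"
      using ic(1) by (rule Ck_on_2D)
    then have "continuous_on (chart_dom c) (\<lambda>p. in_chart c u (coord c p))"
      by (rule continuous_on_compose2)
         (use ic(2) in \<open>auto simp: homeomorphism_def chart_img_def\<close>)
    moreover have "p \<in> chart_dom c \<Longrightarrow> in_chart c u (coord c p) = u p" for p
      using ic(2) by (simp add: in_chart_def homeomorphism_def)
    ultimately show ?thesis by (simp cong: continuous_on_cong)
  qed
  moreover have "open (chart_dom c)" if "c \<in> A" for c
    using assms(1) that unfolding smooth_closed_manifold_def is_chart_def by blast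
  ultimately have "continuous_on (\<Union>c\<in>A. chart_dom c) u"
    by (intro continuous_on_open_UN) auto
  then show ?thesis
    using assms(1) unfolding smooth_closed_manifold_def by simp
qed

text \<open>The product is continuous on a compact space, hence bounded, and the Riemannian measure is
  finite because its real-valued volume is not \<open>0\<close>, the value given to infinite volume.\<close>

lemma integrable_C2a_mult:
  fixes A :: "('m::t2_space, 'n::finite) chart set"
  assumes "smooth_closed_manifold A" "riem_volume A g = 1" "u \<in> C2a \<alpha> A" "v \<in> C2a \<alpha> A"
  shows "integrable (riem_measure A g) (\<lambda>p. u p * v p)"
proof -
  let ?M = "riem_measure A g"
  have sets: "sets ?M = sets borel" and space: "space ?M = UNIV"
    unfolding riem_measure_def
    using sets.sigma_sets_eq[of "borel :: 'm measure"]
    by (auto simp: sets_measure_of_conv space_measure_of_conv)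
  interpret finite_measure ?M
    by (rule finite_measureI) (use assms(2) in \<open>auto simp: riem_volume_def measure_def space\<close>)
  have c: "continuous_on UNIV (\<lambda>p. u p * v p)"
    using assms by (intro continuous_intros continuous_C2a[OF assms(1)])
  have "compact (UNIV :: 'm set)" using assms(1) by (simp add: smooth_closed_manifold_def)
  then have "bounded (range (\<lambda>p. u p * v p))"
    using c compact_continuous_image compact_imp_bounded by blast
  then obtain B where "\<And>p. norm (u p * v p) \<le> B"
    unfolding bounded_iff by blast
  moreover have "(\<lambda>p. u p * v p) \<in> borel_measurable ?M"
    using borel_measurable_continuous_onI[OF c] by (simp add: sets cong: measurable_cong_sets)
  ultimately show ?thesis
    by (intro integrable_const_bound[of _ B]) auto
qed

definition kernel_vec :: "nat \<Rightarrow> (nat \<Rightarrow> 'm \<Rightarrow> real) \<Rightarrow> (nat \<Rightarrow> real) \<Rightarrow> 'm \<Rightarrow> real" where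
  "kernel_vec d e x = (\<lambda>p. \<Sum>i<d. x i * e i p)"

lemma Lambda0_kernel_vec:
  assumes "kernel_basis \<alpha> A g d e"
  shows "Lambda0 \<alpha> A g = range (kernel_vec d e)"
  using assms unfolding kernel_basis_def kernel_vec_def by blast

lemma L2_inner_kernel_vec:
  fixes A :: "('m::t2_space, 'n::finite) chart set"
  assumes "smooth_closed_manifold A" "riem_volume A g = 1" "kernel_basis \<alpha> A g d e"
  shows "i < d \<Longrightarrow> L2_inner A g (kernel_vec d e x) (e i) = x i"
    and "L2_inner A g (kernel_vec d e x) (kernel_vec d e x) = (\<Sum>i<d. x i ^ 2)"
proof -
  let ?M = "riem_measure A g"
  have mem: "kernel_vec d e y \<in> C2a \<alpha> A" for y
    using Lambda0_kernel_vec[OF assms(3)] unfolding Lambda0_def by blast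
  have "e i = kernel_vec d e (\<lambda>k. if k = i then 1 else 0)" if "i < d" for i
    using that by (simp add: kernel_vec_def if_distrib[of "\<lambda>a. a * _"] sum.delta cong: if_cong)
  then have e: "e i \<in> C2a \<alpha> A" if "i < d" for i
    using mem that by metis
  have ortho: "L2_inner A g (e i) (e j) = (if i = j then 1 else 0)" if "i < d" "j < d" for i j
    using assms(3) that unfolding kernel_basis_def by blast
  have lin: "L2_inner A g (kernel_vec d e x) u = (\<Sum>i<d. x i * L2_inner A g (e i) u)"
    if u: "u \<in> C2a \<alpha> A" for u
  proof -
    have "L2_inner A g (kernel_vec d e x) u = (\<integral>p. (\<Sum>i<d. x i * (e i p * u p)) \<partial>?M)"
      unfolding L2_inner_def kernel_vec_def by (simp add: sum_distrib_right mult.assoc)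
    also have "\<dots> = (\<Sum>i<d. \<integral>p. x i * (e i p * u p) \<partial>?M)"
      by (rule Bochner_Integration.integral_sum) (use integrable_C2a_mult[OF assms(1,2) e u] in auto)
    finally show ?thesis unfolding L2_inner_def by simp
  qed
  show coord: "L2_inner A g (kernel_vec d e x) (e i) = x i" if "i < d" for i
  proof -
    have "L2_inner A g (kernel_vec d e x) (e i) = (\<Sum>k<d. x k * (if k = i then 1 else 0))"
      unfolding lin[OF e[OF that]] by (intro sum.cong) (auto simp: ortho that)
    then show ?thesis using that by (simp add: if_distrib[of "\<lambda>a. _ * a"] sum.delta cong: if_cong)
  qed
  have "L2_inner A g (e i) (kernel_vec d e x) = x i" if "i < d" for i
    using coord[OF that] by (simp add: L2_inner_def mult.commute)
  then show "L2_inner A g (kernel_vec d e x) (kernel_vec d e x) = (\<Sum>i<d. x i ^ 2)"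
    unfolding lin[OF mem] by (simp add: power2_eq_square)
qed

lemma Lambda0_scale:
  assumes "kernel_basis \<alpha> A g d e" "v \<in> Lambda0 \<alpha> A g"
  shows "(\<lambda>p. t * v p) \<in> Lambda0 \<alpha> A g"
proof -
  obtain x where "v = kernel_vec d e x" using assms Lambda0_kernel_vec by blast
  then have "(\<lambda>p. t * v p) = kernel_vec d e (\<lambda>i. t * x i)"
    by (simp add: kernel_vec_def sum_distrib_left mult.assoc)
  then show ?thesis using Lambda0_kernel_vec[OF assms(1)] by blast
qed

lemma L2_norm_scale: "L2_norm A g (\<lambda>p. t * v p) = \<bar>t\<bar> * L2_norm A g v"
proof -
  have "L2_inner A g (\<lambda>p. t * v p) (\<lambda>p. t * v p) = t\<^sup>2 * L2_inner A g v v"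
    by (simp add: L2_inner_def power2_eq_square mult_ac flip: integral_mult_right_zero)
  then show ?thesis by (simp add: L2_norm_def real_sqrt_mult)
qed

section \<open>Homogeneous polynomials on the kernel\<close>

lemma homogeneous_poly_scale:
  assumes "homogeneous_poly \<alpha> A g j Q" "v \<in> Lambda0 \<alpha> A g"
  shows "Q (\<lambda>p. t * v p) = t ^ j * Q v"
proof -
  obtain d e a where b: "kernel_basis \<alpha> A g d e"
    and Q: "\<And>v. v \<in> Lambda0 \<alpha> A g \<Longrightarrow> Q v = (\<Sum>\<beta> | \<beta> \<in> multi_indices d \<and> mi_order d \<beta> = j.
        a \<beta> * monomial d \<beta> (\<lambda>i. L2_inner A g v (e i)))"
    using assms(1) unfolding homogeneous_poly_def by blast
  have "L2_inner A g (\<lambda>p. t * v p) u = t * L2_inner A g v u" for u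
    by (simp add: L2_inner_def mult.assoc)
  moreover have "monomial d \<beta> (\<lambda>i. t * x i) = t ^ mi_order d \<beta> * monomial d \<beta> x" for \<beta> x
    by (simp add: monomial_def mi_order_def power_mult_distrib prod.distrib power_sum)
  ultimately show ?thesis
    unfolding Q[OF assms(2)] Q[OF Lambda0_scale[OF b assms(2)]]
    by (simp add: sum_distrib_left mult_ac)
qed

text \<open>Coordinate vectors are sequences in the product topology; once the coordinates from \<open>d\<close> on
  are pinned to \<open>0\<close>, the sphere is a closed subset of a product of compact intervals, to which
  Tychonoff's theorem applies.\<close>

lemma compact_coordinate_sphere:
  "compact {x :: nat \<Rightarrow> real. (\<forall>i\<ge>d. x i = 0) \<and> (\<Sum>i<d. x i ^ 2) = 1}"
proof -
  let ?B = "PiE UNIV (\<lambda>i. if i < d then {-1..1} else {0::real})"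
  have co: "continuous_on UNIV (\<lambda>x :: nat \<Rightarrow> real. x i)" for i
    by (rule continuous_on_product_coordinates)
  have "compactin (product_topology (\<lambda>_. euclidean) UNIV) ?B"
    by (subst compactin_PiE) auto
  then have "compact ?B" by (simp add: euclidean_product_topology)
  moreover have "closed {x :: nat \<Rightarrow> real. (\<Sum>i<d. x i ^ 2) = 1}"
    by (intro closed_Collect_eq continuous_intros co)
  ultimately have "compact (?B \<inter> {x. (\<Sum>i<d. x i ^ 2) = 1})"
    by (rule compact_Int_closed)
  moreover have "\<bar>x i\<bar> \<le> 1" if "(\<Sum>i<d. x i ^ 2) = 1" "i < d" for x :: "nat \<Rightarrow> real" and i
  proof -
    have "x i ^ 2 \<le> (\<Sum>i<d. x i ^ 2)" using that(2) by (intro member_le_sum) auto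
    then show ?thesis using that(1) by (simp add: abs_square_le_1)
  qed
  then have "?B \<inter> {x. (\<Sum>i<d. x i ^ 2) = 1} = {x. (\<forall>i\<ge>d. x i = 0) \<and> (\<Sum>i<d. x i ^ 2) = 1}"
    by (fastforce simp: PiE_iff abs_le_iff split: if_splits)
  ultimately show ?thesis by simp
qed

text \<open>In orthonormal coordinates the unit sphere of the kernel is the Euclidean sphere, and \<open>Q\<close> is a
  polynomial in these coordinates, hence continuous.\<close>

lemma homogeneous_poly_attains_max:
  fixes A :: "('m::t2_space, 'n::finite) chart set"
  assumes "smooth_closed_manifold A" "riem_volume A g = 1" "homogeneous_poly \<alpha> A g j Q"
    and "kernel_sphere \<alpha> A g \<noteq> {}"
  shows "\<exists>v\<in>kernel_sphere \<alpha> A g. \<forall>u\<in>kernel_sphere \<alpha> A g. Q u \<le> Q v"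
proof -
  obtain d e a where b: "kernel_basis \<alpha> A g d e"
    and Q: "\<And>v. v \<in> Lambda0 \<alpha> A g \<Longrightarrow> Q v = (\<Sum>\<beta> | \<beta> \<in> multi_indices d \<and> mi_order d \<beta> = j.
        a \<beta> * monomial d \<beta> (\<lambda>i. L2_inner A g v (e i)))"
    using assms(3) unfolding homogeneous_poly_def by blast
  let ?S = "{x :: nat \<Rightarrow> real. (\<forall>i\<ge>d. x i = 0) \<and> (\<Sum>i<d. x i ^ 2) = 1}"
  let ?P = "\<lambda>x. \<Sum>\<beta> | \<beta> \<in> multi_indices d \<and> mi_order d \<beta> = j. a \<beta> * monomial d \<beta> x"
  have QP: "Q (kernel_vec d e x) = ?P x" for x
  proof -
    have "kernel_vec d e x \<in> Lambda0 \<alpha> A g" using Lambda0_kernel_vec[OF b] by blast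
    moreover have "monomial d \<beta> (\<lambda>i. L2_inner A g (kernel_vec d e x) (e i)) = monomial d \<beta> x" for \<beta>
      unfolding monomial_def
      by (intro prod.cong) (auto simp: L2_inner_kernel_vec(1)[OF assms(1,2) b])
    ultimately show ?thesis by (simp add: Q)
  qed
  have sphere: "kernel_sphere \<alpha> A g = kernel_vec d e ` ?S"
  proof (intro subset_antisym subsetI)
    fix v assume v: "v \<in> kernel_sphere \<alpha> A g"
    then obtain x where x: "v = kernel_vec d e x"
      unfolding kernel_sphere_def using Lambda0_kernel_vec[OF b] by blast
    let ?y = "\<lambda>i. if i < d then x i else 0"
    have "kernel_vec d e x = kernel_vec d e ?y" by (simp add: kernel_vec_def)
    moreover have "(\<Sum>i<d. x i ^ 2) = 1"
      using v by (simp add: x kernel_sphere_def L2_norm_def L2_inner_kernel_vec(2)[OF assms(1,2) b])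
    then have "?y \<in> ?S" by simp
    ultimately show "v \<in> kernel_vec d e ` ?S" using x by blast
  next
    fix v assume "v \<in> kernel_vec d e ` ?S"
    then show "v \<in> kernel_sphere \<alpha> A g"
      using Lambda0_kernel_vec[OF b]
      by (auto simp: kernel_sphere_def L2_norm_def L2_inner_kernel_vec(2)[OF assms(1,2) b])
  qed
  have "continuous_on UNIV ?P"
    unfolding monomial_def
    by (intro continuous_intros continuous_on_product_coordinates)
  then have "continuous_on ?S ?P" by (rule continuous_on_subset) simp
  moreover have "?S \<noteq> {}" using assms(4) sphere by auto
  ultimately have "\<exists>x\<in>?S. \<forall>y\<in>?S. ?P y \<le> ?P x"
    by (intro continuous_attains_sup compact_coordinate_sphere)
  then show ?thesis unfolding sphere by (auto simp: QP)
qed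

section \<open>The reduced functional at a strict local minimum\<close>

text \<open>The quotient \<open>f t / t\<^sup>p\<close> is the sum of a power series, so it tends to \<open>c 0\<close> as \<open>t\<close> decreases
  to \<open>0\<close>. Convergence at one \<open>t > 0\<close> already gives convergence for negative arguments, which the
  two-sided limit of power series requires.\<close>

lemma leading_coeff_nonneg:
  fixes c :: "nat \<Rightarrow> real"
  assumes "s > 0" "\<And>t. 0 < t \<Longrightarrow> t < s \<Longrightarrow> (\<lambda>k. c k * t ^ (p + k)) sums f t"
    and "\<And>t. 0 < t \<Longrightarrow> t < s \<Longrightarrow> 0 \<le> f t"
  shows "0 \<le> c 0"
proof -
  have sums: "(\<lambda>k. c k * t ^ k) sums (f t / t ^ p)" if "0 < t" "t < s" for t
    using sums_divide[OF assms(2)[OF that], of "t ^ p"] that by (simp add: power_add)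
  have conv: "(\<lambda>k. c k * t ^ k) sums (\<Sum>k. c k * t ^ k)" if "norm t < s / 2" for t
    using powser_inside[OF sums_summable[OF sums[of "s / 2"]], of t] that assms(1)
    by (simp add: summable_sums)
  have "((\<lambda>t. \<Sum>k. c k * t ^ k) \<longlongrightarrow> c 0) (at 0)"
    by (rule powser_limit_0[of "s / 2"]) (use assms(1) conv in auto)
  then have "((\<lambda>t. \<Sum>k. c k * t ^ k) \<longlongrightarrow> c 0) (at_right 0)"
    by (rule tendsto_mono[rotated]) (simp add: at_le)
  moreover have "eventually (\<lambda>t. 0 \<le> (\<Sum>k. c k * t ^ k)) (at_right 0)"
    unfolding eventually_at_right_field
  proof (intro exI[of _ s] conjI allI impI)
    fix t :: real assume t: "0 < t" "t < s"
    show "0 \<le> (\<Sum>k. c k * t ^ k)"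
      using sums_unique[OF sums[OF t]] divide_nonneg_nonneg[OF assms(3)[OF t], of "t ^ p"] t by simp
  qed (use assms(1) in auto)
  ultimately show ?thesis by (rule tendsto_lowerbound) simp
qed

text \<open>On the ray through \<open>v\<close>, the deviation \<open>t v + \<Phi>(t v)\<close> of the conformal factor from \<open>1\<close> has
  \<open>C\<^sup>2\<^sup>,\<^sup>\<alpha>\<close>-norm \<open>O(t)\<close>, so strict minimality applies for small \<open>t\<close>. The inequality obtained is
  weak: it includes the case in which the conformal factor equals \<open>1\<close>.\<close>

lemma reduced_functional_ray_min:
  fixes A :: "('m::t2_space, 'n::finite) chart set"
  assumes "smooth_closed_manifold A" "strict_local_min \<alpha> A g" "LS_reduction \<alpha> A g \<epsilon> \<Phi>"
    and "v \<in> Lambda0 \<alpha> A g"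
  shows "\<exists>s>0. \<forall>t. 0 < t \<and> t < s \<longrightarrow>
    reduced_functional A g \<Phi> (\<lambda>_. 0) \<le> reduced_functional A g \<Phi> (\<lambda>p. t * v p)"
proof -
  obtain \<delta> where \<delta>: "\<delta> > 0" "\<And>w. w \<in> conf_class \<alpha> A g \<Longrightarrow> w \<noteq> (\<lambda>_. 1) \<Longrightarrow>
      C2a_norm \<alpha> A (\<lambda>p. w p - 1) < \<delta> \<Longrightarrow> yamabe_conf A g w > yamabe_conf A g (\<lambda>_. 1)"
    using assms(2) unfolding strict_local_min_def by blast
  have LS: "\<epsilon> > 0" "analytic_to_C2a \<alpha> A g \<epsilon> \<Phi>" "\<Phi> (\<lambda>_. 0) = (\<lambda>_. 0)"
    "\<forall>\<eta>>0. \<exists>\<delta>>0. \<forall>v\<in>kernel_ball \<alpha> A g \<epsilon>. L2_norm A g v < \<delta> \<longrightarrow>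
        C2a_norm \<alpha> A (\<Phi> v) \<le> \<eta> * L2_norm A g v"
    "\<And>v. v \<in> kernel_ball \<alpha> A g \<epsilon> \<Longrightarrow> \<Phi> v \<in> C2a_perp \<alpha> A g"
    "\<And>v. v \<in> kernel_ball \<alpha> A g \<epsilon> \<Longrightarrow> LS_map \<Phi> v \<in> conf_class \<alpha> A g"
    using assms(3) unfolding LS_reduction_def by blast+
  obtain d e where b: "kernel_basis \<alpha> A g d e"
    using LS(2) unfolding analytic_to_C2a_def by blast
  obtain \<rho> where \<rho>: "\<rho> > 0" "\<And>v. v \<in> kernel_ball \<alpha> A g \<epsilon> \<Longrightarrow> L2_norm A g v < \<rho> \<Longrightarrow>
      C2a_norm \<alpha> A (\<Phi> v) \<le> 1 * L2_norm A g v"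
    using LS(4) zero_less_one by blast
  \<comment> \<open>At parameter \<open>t > 0\<close>, \<open>t * C\<close> bounds both the \<open>L\<^sup>2\<close>-norm of \<open>t v\<close> and the
    \<open>C\<^sup>2\<^sup>,\<^sup>\<alpha>\<close>-norm of \<open>t v + \<Phi>(t v)\<close>.\<close>
  define C where "C = 1 + L2_norm A g v + \<bar>C2a_norm \<alpha> A v\<bar>"
  have "0 \<le> L2_norm A g v" by (simp add: L2_norm_def L2_inner_def)
  then have C: "C > 0" "L2_norm A g v \<le> C" "C2a_norm \<alpha> A v + L2_norm A g v \<le> C"
    by (auto simp: C_def)
  define s where "s = Min {\<delta>, \<epsilon>, \<rho>} / C"
  have "reduced_functional A g \<Phi> (\<lambda>_. 0) \<le> reduced_functional A g \<Phi> (\<lambda>p. t * v p)"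
    if t: "0 < t" "t < s" for t
  proof -
    let ?u = "\<lambda>p. t * v p"
    have small: "t * C < \<delta>" "t * C < \<epsilon>" "t * C < \<rho>"
      using t C(1) by (auto simp: s_def pos_less_divide_eq)
    have u: "?u \<in> Lambda0 \<alpha> A g" by (rule Lambda0_scale[OF b assms(4)])
    have "L2_norm A g ?u = t * L2_norm A g v" using t by (simp add: L2_norm_scale)
    moreover have "t * L2_norm A g v \<le> t * C" using t C by simp
    ultimately have nu: "L2_norm A g ?u = t * L2_norm A g v" "L2_norm A g ?u < \<epsilon>" "L2_norm A g ?u < \<rho>"
      using small by linarith+
    have ball: "?u \<in> kernel_ball \<alpha> A g \<epsilon>" using u nu by (simp add: kernel_ball_def)
    have vC: "v \<in> C2a \<alpha> A" using assms(4) by (simp add: Lambda0_def)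
    have \<Phi>C: "\<Phi> ?u \<in> C2a \<alpha> A" using LS(5)[OF ball] by (simp add: C2a_perp_def)
    have "C2a_norm \<alpha> A (\<lambda>p. LS_map \<Phi> ?u p - 1) = C2a_norm \<alpha> A (\<lambda>p. t * v p + \<Phi> ?u p)"
      by (simp add: LS_map_def)
    also have "\<dots> \<le> \<bar>t\<bar> * C2a_norm \<alpha> A v + C2a_norm \<alpha> A (\<Phi> ?u)"
      by (rule C2a_norm_lincomb_le[OF assms(1) vC \<Phi>C])
    also have "\<dots> \<le> t * (C2a_norm \<alpha> A v + L2_norm A g v)"
      using \<rho>(2)[OF ball nu(3)] nu(1) t by (simp add: algebra_simps)
    also have "\<dots> \<le> t * C" using t C by simp
    finally have "C2a_norm \<alpha> A (\<lambda>p. LS_map \<Phi> ?u p - 1) < \<delta>" using small by linarith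
    then have "yamabe_conf A g (\<lambda>_. 1) \<le> yamabe_conf A g (LS_map \<Phi> ?u)"
      using \<delta>(2)[OF LS(6)[OF ball]] by fastforce
    then show ?thesis by (simp add: reduced_functional_def LS(3) LS_map_def[of \<Phi> "\<lambda>_. 0"])
  qed
  moreover have "s > 0" using \<delta> \<rho> LS(1) C(1) by (simp add: s_def)
  ultimately show ?thesis by blast
qed

lemma leading_term_nonneg:
  fixes A :: "('m::t2_space, 'n::finite) chart set"
  assumes "leading_expansion \<alpha> A g F p Q" "v \<in> Lambda0 \<alpha> A g"
    and "\<exists>s>0. \<forall>t. 0 < t \<and> t < s \<longrightarrow> F (\<lambda>_. 0) \<le> F (\<lambda>p. t * v p)"
  shows "0 \<le> Q p v"
proof -
  have hom: "\<And>k. homogeneous_poly \<alpha> A g (p + k) (Q (p + k))"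
    using assms(1) unfolding leading_expansion_def by simp
  obtain r where r: "r > 0" "\<And>v. v \<in> kernel_ball \<alpha> A g r \<Longrightarrow>
      (\<lambda>k. Q (p + k) v) sums (F v - F (\<lambda>_. 0))"
    using assms(1) unfolding leading_expansion_def by blast
  obtain d e where b: "kernel_basis \<alpha> A g d e"
    using hom[of 0] unfolding homogeneous_poly_def by blast
  obtain s where s: "s > 0" "\<And>t. 0 < t \<Longrightarrow> t < s \<Longrightarrow> F (\<lambda>_. 0) \<le> F (\<lambda>p. t * v p)"
    using assms(3) by blast
  have n: "0 \<le> L2_norm A g v" by (simp add: L2_norm_def L2_inner_def)
  define s' where "s' = min s (r / (1 + L2_norm A g v))"
  have "0 \<le> Q (p + 0) v"
  proof (rule leading_coeff_nonneg[where c = "\<lambda>k. Q (p + k) v" and s = s' and p = p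
        and f = "\<lambda>t. F (\<lambda>p. t * v p) - F (\<lambda>_. 0)"])
    show "s' > 0" using s r n by (simp add: s'_def)
    fix t assume t: "0 < t" "t < s'"
    show "0 \<le> F (\<lambda>p. t * v p) - F (\<lambda>_. 0)" using s(2) t by (simp add: s'_def)
    have "t * (1 + L2_norm A g v) < r" using t n by (simp add: s'_def pos_less_divide_eq)
    then have "t * L2_norm A g v < r" using t by (simp add: algebra_simps)
    then have "(\<lambda>p. t * v p) \<in> kernel_ball \<alpha> A g r"
      using Lambda0_scale[OF b assms(2)] t by (simp add: kernel_ball_def L2_norm_scale)
    from r(2)[OF this] show "(\<lambda>k. Q (p + k) v * t ^ (p + k)) sums (F (\<lambda>p. t * v p) - F (\<lambda>_. 0))"
      by (simp add: homogeneous_poly_scale[OF hom assms(2)] mult.commute)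
  qed
  then show ?thesis by simp
qed

text \<open>The argument at which \<open>Q\<close> is positive can be rescaled to norm \<open>1\<close>: if its norm vanished, so would
  its coordinates, and a homogeneous polynomial of positive degree vanishes at \<open>0\<close>.\<close>

lemma homogeneous_poly_normalize:
  fixes A :: "('m::t2_space, 'n::finite) chart set"
  assumes "smooth_closed_manifold A" "riem_volume A g = 1" "homogeneous_poly \<alpha> A g j Q" "j > 0"
    and "v \<in> Lambda0 \<alpha> A g" "Q v > 0"
  shows "\<exists>u\<in>kernel_sphere \<alpha> A g. Q u > 0"
proof -
  obtain d e where b: "kernel_basis \<alpha> A g d e"
    using assms(3) unfolding homogeneous_poly_def by blast
  obtain x where x: "v = kernel_vec d e x" using assms(5) Lambda0_kernel_vec[OF b] by blast
  have n: "L2_norm A g v > 0"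
  proof (rule ccontr)
    assume "\<not> ?thesis"
    then have "(\<Sum>i<d. x i ^ 2) \<le> 0"
      by (simp add: x L2_norm_def L2_inner_kernel_vec(2)[OF assms(1,2) b])
    then have "(\<Sum>i<d. x i ^ 2) = 0" by (simp add: antisym sum_nonneg)
    then have "\<forall>i<d. x i = 0" by (subst (asm) sum_nonneg_eq_0_iff) auto
    then have "v = (\<lambda>p. 0 * v p)" by (simp add: x kernel_vec_def)
    then have "Q v = 0 ^ j * Q v" using homogeneous_poly_scale[OF assms(3,5), of 0] by simp
    then show False using assms(4,6) by (simp add: zero_power)
  qed
  let ?t = "1 / L2_norm A g v"
  have "(\<lambda>p. ?t * v p) \<in> kernel_sphere \<alpha> A g"
    unfolding kernel_sphere_def using Lambda0_scale[OF b assms(5), of ?t] L2_norm_scale[of A g ?t v] n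
    by simp
  moreover have "Q (\<lambda>p. ?t * v p) > 0"
    unfolding homogeneous_poly_scale[OF assms(3,5)] using n assms(6) by simp
  ultimately show ?thesis by blast
qed

theorem mainTheorem7:
  fixes A :: "('m::t2_space, 'n::finite) chart set"
    and g :: "('m, 'n) metric_field"
    and \<alpha> :: real and p :: nat
  assumes "smooth_closed_manifold A"
    and "CARD('n) \<ge> 3"
    and "0 < \<alpha>" and "\<alpha> < 1"
    and "riemannian_metric A g"
    and "riem_volume A g = 1"
    and "constant_scalar_curv A g"
    and "has_order_of_integrability \<alpha> A g p"
    and "p > 3"
    and "degenerate \<alpha> A g"
    and "strict_local_min \<alpha> A g"
  shows "AS_condition \<alpha> A g p"
proof -
  obtain \<epsilon> \<Phi> Q where nonint: "\<not> integrable_metric \<alpha> A g" and LS: "LS_reduction \<alpha> A g \<epsilon> \<Phi>"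
    and expand: "leading_expansion \<alpha> A g (reduced_functional A g \<Phi>) p Q"
    using assms(8) unfolding has_order_of_integrability_def by blast
  have hom: "homogeneous_poly \<alpha> A g p (Q p)"
    using expand unfolding leading_expansion_def by blast
  obtain v where v: "v \<in> Lambda0 \<alpha> A g" "Q p v \<noteq> 0"
    using expand unfolding leading_expansion_def by blast
  have "0 \<le> Q p v"
    using leading_term_nonneg[OF expand v(1)] reduced_functional_ray_min[OF assms(1,11) LS v(1)] .
  then have "Q p v > 0" using v(2) by simp
  then obtain u where u: "u \<in> kernel_sphere \<alpha> A g" "Q p u > 0"
    using homogeneous_poly_normalize[OF assms(1,6) hom _ v(1)] assms(9) by auto
  then obtain w where "w \<in> kernel_sphere \<alpha> A g" "\<forall>u\<in>kernel_sphere \<alpha> A g. Q p u \<le> Q p w"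
    using homogeneous_poly_attains_max[OF assms(1,6) hom] by blast
  moreover have "Q p w > 0" using u calculation by force
  ultimately show ?thesis unfolding AS_condition_def using nonint LS expand by blast
qed

end
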